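(* Let $T:V\to A$ be a relative Rota-Baxter operator on a Hom-Leibniz Poisson algebra $(A,\cdot,[,],\alpha)$ with respect to a representation $(V,\lambda^l,\lambda^r,\rho^l,\rho^r,\phi)$. Equip $V$ with the Hom-Leibniz Poisson algebra structure $(V,\diamond,[,]_T,\phi)$ given by $u\diamond v:=\lambda^l(Tu)v+\lambda^r(Tv)u$ and $[u,v]_T:=\rho^l(Tu)v+\rho^r(Tv)u$ for $u,v\in V$. Define linear maps $\overline{\lambda^l},\overline{\lambda^r},\overline{\rho^l},\overline{\rho^r}:V\to gl(A)$ by, for all $(x,u)\in A\times V$, $$\overline{\lambda^l}(u)x:=Tu\cdot x-T(\lambda^r(x)u),\qquad \overline{\lambda^r}(u)x:=x\cdot Tu-T(\lambda^l(x)u),$$ $$\overline{\rho^l}(u)x:=[Tu,x]-T(\rho^r(x)u),\qquad \overline{\rho^r}(u)x:=[x,Tu]-T(\rho^l(x)u).$$ Then $(A,\overline{\lambda^l},\overline{\lambda^r},\overline{\rho^l},\overline{\rho^r},\alpha)$ is a representation of the Hom-Leibniz Poisson algebra $(V,\diamond,[,]_T,\phi)$.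
   Context: All vector spaces are over a field $\mathbb K$ of characteristic $0$; $gl(V)$ is the space of linear endomorphisms of $V$, and juxtaposition of operators is composition. A Hom-associative algebra $(A,\cdot,\alpha)$ is a vector space $A$ with a bilinear product and a linear map $\alpha:A\to A$ such that $\alpha(x\cdot y)=\alpha(x)\cdot\alpha(y)$ and $(x\cdot y)\cdot\alpha(z)=\alpha(x)\cdot(y\cdot z)$. A (right) Hom-Leibniz algebra $(A,[,],\alpha)$ is a vector space with a bilinear bracket and a linear map $\alpha$ such that $\alpha([x,y])=[\alpha(x),\alpha(y)]$ and $[[x,y],\alpha(z)]=[\alpha(x),[y,z]]+[[x,z],\alpha(y)]$. A Hom-Leibniz Poisson algebra $(A,\cdot,[,],\alpha)$ is such that $(A,\cdot,\alpha)$ is Hom-associative, $(A,[,],\alpha)$ is Hom-Leibniz, and $[x\cdot y,\alpha(z)]=\alpha(x)\cdot[y,z]+[x,z]\cdot\alpha(y)$ for all $x,y,z\in A$. A representation of a Hom-associative algebra $(A,\cdot,\alpha)$ is $(V,\lambda^l,\lambda^r,\phi)$ with $V$ a vector space, $\phi\in gl(V)$, and $\lambda^l,\lambda^r:A\to gl(V)$ linear such that for all $x,y\in A$: $\phi\lambda^l(x)=\lambda^l(\alpha(x))\phi$; $\phi\lambda^r(x)=\lambda^r(\alpha(x))\phi$; $\lambda^l(x\cdot y)\phi=\lambda^l(\alpha(x))\lambda^l(y)$; $\lambda^r(x\cdot y)\phi=\lambda^r(\alpha(y))\lambda^r(x)$; $\lambda^l(\alpha(x))\lambda^r(y)=\lambda^r(\alpha(y))\lambda^l(x)$.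 A representation of a Hom-Leibniz algebra $(A,[,],\alpha)$ is $(V,\rho^l,\rho^r,\phi)$ with $\phi\in gl(V)$ and $\rho^l,\rho^r:A\to gl(V)$ linear such that for all $x,y\in A$: $\rho^l(\alpha(x))\phi=\phi\rho^l(x)$; $\rho^r(\alpha(x))\phi=\phi\rho^r(x)$; $\rho^l([x,y])\phi=\rho^l(\alpha(x))\rho^l(y)+\rho^r(\alpha(y))\rho^l(x)$; $\rho^r(\alpha(y))\rho^l(x)=\rho^l(\alpha(x))\rho^r(y)+\rho^l([x,y])\phi$; $\rho^r(\alpha(y))\rho^r(x)=\rho^r([x,y])\phi+\rho^r(\alpha(x))\rho^r(y)$. A representation of a Hom-Leibniz Poisson algebra $(A,\cdot,[,],\alpha)$ is $(V,\lambda^l,\lambda^r,\rho^l,\rho^r,\phi)$ such that $(V,\lambda^l,\lambda^r,\phi)$ is a representation of $(A,\cdot,\alpha)$, $(V,\rho^l,\rho^r,\phi)$ is a representation of $(A,[,],\alpha)$, and for all $x,y\in A$: $\rho^r(\alpha(y))\lambda^l(x)=\lambda^l(\alpha(x))\rho^r(y)+\lambda^l([x,y])\phi$; $\rho^r(\alpha(y))\lambda^r(x)=\lambda^r([x,y])\phi+\lambda^r(\alpha(x))\rho^r(y)$; $\rho^l(x\cdot y)\phi=\lambda^l(\alpha(x))\rho^l(y)+\lambda^r(\alpha(y))\rho^l(x)$. A relative Rota-Baxter operator on $(A,\cdot,[,],\alpha)$ with respect to a representation $(V,\lambda^l,\lambda^r,\rho^l,\rho^r,\phi)$ is a linear map $T:V\to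 A$ with $T\phi=\alpha T$, $Tu\cdot Tv=T(\lambda^l(Tu)v+\lambda^r(Tv)u)$ and $[Tu,Tv]=T(\rho^l(Tu)v+\rho^r(Tv)u)$ for all $u,v\in V$. *)

theory Defs
  imports Complex_Main
begin

text \<open>
  A vector space is a type of class ab_group_add with a scalar multiplication over a field of
  characteristic 0. The endomorphism space \<open>gl\<close> is a set of functions, with pointwise
  operations; a linear map into it is linear after evaluation at every vector. The equations
  between operators below are likewise stated after evaluation at a vector \<open>v\<close>.
\<close>

definition gl :: "('k::field \<Rightarrow> 'v::ab_group_add \<Rightarrow> 'v) \<Rightarrow> ('v \<Rightarrow> 'v) set" where
  "gl s = {f. Vector_Spaces.linear s s f}"

definition linear_into_gl ::
  "('k::field \<Rightarrow> 'a::ab_group_add \<Rightarrow> 'a) \<Rightarrow> ('k \<Rightarrow> 'v::ab_group_add \<Rightarrow> 'v)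
    \<Rightarrow> ('a \<Rightarrow> 'v \<Rightarrow> 'v) \<Rightarrow> bool" where
  "linear_into_gl sA sV f \<longleftrightarrow>
     (\<forall>x. f x \<in> gl sV) \<and> (\<forall>v. Vector_Spaces.linear sA sV (\<lambda>x. f x v))"

definition bilinear_product ::
  "('k::field \<Rightarrow> 'a::ab_group_add \<Rightarrow> 'a) \<Rightarrow> ('a \<Rightarrow> 'a \<Rightarrow> 'a) \<Rightarrow> bool" where
  "bilinear_product s m \<longleftrightarrow>
     (\<forall>x. Vector_Spaces.linear s s (\<lambda>y. m x y)) \<and> (\<forall>y. Vector_Spaces.linear s s (\<lambda>x. m x y))"

locale hom_associative_algebra =
  vector_space sA
  for sA :: "'k::field_char_0 \<Rightarrow> 'a::ab_group_add \<Rightarrow> 'a" +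
  fixes mult :: "'a \<Rightarrow> 'a \<Rightarrow> 'a"
    and \<alpha> :: "'a \<Rightarrow> 'a"
  assumes mult_bilinear: "bilinear_product sA mult"
    and twist_linear: "Vector_Spaces.linear sA sA \<alpha>"
    and twist_mult: "\<alpha> (mult x y) = mult (\<alpha> x) (\<alpha> y)"
    and hom_associative: "mult (mult x y) (\<alpha> z) = mult (\<alpha> x) (mult y z)"

locale hom_leibniz_algebra =
  vector_space sA
  for sA :: "'k::field_char_0 \<Rightarrow> 'a::ab_group_add \<Rightarrow> 'a" +
  fixes br :: "'a \<Rightarrow> 'a \<Rightarrow> 'a"
    and \<alpha> :: "'a \<Rightarrow> 'a"
  assumes br_bilinear: "bilinear_product sA br"
    and br_twist_linear: "Vector_Spaces.linear sA sA \<alpha>"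
    and twist_br: "\<alpha> (br x y) = br (\<alpha> x) (\<alpha> y)"
    and hom_leibniz: "br (br x y) (\<alpha> z) = br (\<alpha> x) (br y z) + br (br x z) (\<alpha> y)"

locale hom_leibniz_poisson_algebra =
  hom_associative_algebra sA mult \<alpha> + hom_leibniz_algebra sA br \<alpha>
  for sA :: "'k::field_char_0 \<Rightarrow> 'a::ab_group_add \<Rightarrow> 'a"
    and mult :: "'a \<Rightarrow> 'a \<Rightarrow> 'a"
    and br :: "'a \<Rightarrow> 'a \<Rightarrow> 'a"
    and \<alpha> :: "'a \<Rightarrow> 'a" +
  assumes hom_poisson: "br (mult x y) (\<alpha> z) = mult (\<alpha> x) (br y z) + mult (br x z) (\<alpha> y)"

locale hom_associative_rep =
  hom_associative_algebra sA mult \<alpha> + V: vector_space sV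
  for sA :: "'k::field_char_0 \<Rightarrow> 'a::ab_group_add \<Rightarrow> 'a"
    and mult :: "'a \<Rightarrow> 'a \<Rightarrow> 'a"
    and \<alpha> :: "'a \<Rightarrow> 'a"
    and sV :: "'k \<Rightarrow> 'v::ab_group_add \<Rightarrow> 'v" +
  fixes lam_l lam_r :: "'a \<Rightarrow> 'v \<Rightarrow> 'v"
    and \<phi> :: "'v \<Rightarrow> 'v"
  assumes lam_l_linear: "linear_into_gl sA sV lam_l"
    and lam_r_linear: "linear_into_gl sA sV lam_r"
    and phi_gl: "\<phi> \<in> gl sV"
    and phi_lam_l: "\<phi> (lam_l x v) = lam_l (\<alpha> x) (\<phi> v)"
    and phi_lam_r: "\<phi> (lam_r x v) = lam_r (\<alpha> x) (\<phi> v)"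
    and lam_l_mult: "lam_l (mult x y) (\<phi> v) = lam_l (\<alpha> x) (lam_l y v)"
    and lam_r_mult: "lam_r (mult x y) (\<phi> v) = lam_r (\<alpha> y) (lam_r x v)"
    and lam_l_lam_r: "lam_l (\<alpha> x) (lam_r y v) = lam_r (\<alpha> y) (lam_l x v)"

locale hom_leibniz_rep =
  hom_leibniz_algebra sA br \<alpha> + V: vector_space sV
  for sA :: "'k::field_char_0 \<Rightarrow> 'a::ab_group_add \<Rightarrow> 'a"
    and br :: "'a \<Rightarrow> 'a \<Rightarrow> 'a"
    and \<alpha> :: "'a \<Rightarrow> 'a"
    and sV :: "'k \<Rightarrow> 'v::ab_group_add \<Rightarrow> 'v" +
  fixes rho_l rho_r :: "'a \<Rightarrow> 'v \<Rightarrow> 'v"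
    and \<phi> :: "'v \<Rightarrow> 'v"
  assumes rho_l_linear: "linear_into_gl sA sV rho_l"
    and rho_r_linear: "linear_into_gl sA sV rho_r"
    and br_phi_gl: "\<phi> \<in> gl sV"
    and rho_l_phi: "rho_l (\<alpha> x) (\<phi> v) = \<phi> (rho_l x v)"
    and rho_r_phi: "rho_r (\<alpha> x) (\<phi> v) = \<phi> (rho_r x v)"
    and rho_l_br: "rho_l (br x y) (\<phi> v) = rho_l (\<alpha> x) (rho_l y v) + rho_r (\<alpha> y) (rho_l x v)"
    and rho_r_rho_l: "rho_r (\<alpha> y) (rho_l x v) = rho_l (\<alpha> x) (rho_r y v) + rho_l (br x y) (\<phi> v)"
    and rho_r_rho_r: "rho_r (\<alpha> y) (rho_r x v) = rho_r (br x y) (\<phi> v) + rho_r (\<alpha> x) (rho_r y v)"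

locale hom_leibniz_poisson_rep =
  hom_leibniz_poisson_algebra sA mult br \<alpha> +
  hom_associative_rep sA mult \<alpha> sV lam_l lam_r \<phi> +
  hom_leibniz_rep sA br \<alpha> sV rho_l rho_r \<phi>
  for sA :: "'k::field_char_0 \<Rightarrow> 'a::ab_group_add \<Rightarrow> 'a"
    and mult :: "'a \<Rightarrow> 'a \<Rightarrow> 'a"
    and br :: "'a \<Rightarrow> 'a \<Rightarrow> 'a"
    and \<alpha> :: "'a \<Rightarrow> 'a"
    and sV :: "'k \<Rightarrow> 'v::ab_group_add \<Rightarrow> 'v"
    and lam_l lam_r rho_l rho_r :: "'a \<Rightarrow> 'v \<Rightarrow> 'v"
    and \<phi> :: "'v \<Rightarrow> 'v" +
  assumes rho_r_lam_l: "rho_r (\<alpha> y) (lam_l x v) = lam_l (\<alpha> x) (rho_r y v) + lam_l (br x y) (\<phi> v)"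
    and rho_r_lam_r: "rho_r (\<alpha> y) (lam_r x v) = lam_r (br x y) (\<phi> v) + lam_r (\<alpha> x) (rho_r y v)"
    and rho_l_mult: "rho_l (mult x y) (\<phi> v) = lam_l (\<alpha> x) (rho_l y v) + lam_r (\<alpha> y) (rho_l x v)"

locale relative_rota_baxter =
  hom_leibniz_poisson_rep sA mult br \<alpha> sV lam_l lam_r rho_l rho_r \<phi>
  for sA :: "'k::field_char_0 \<Rightarrow> 'a::ab_group_add \<Rightarrow> 'a"
    and mult :: "'a \<Rightarrow> 'a \<Rightarrow> 'a"
    and br :: "'a \<Rightarrow> 'a \<Rightarrow> 'a"
    and \<alpha> :: "'a \<Rightarrow> 'a"
    and sV :: "'k \<Rightarrow> 'v::ab_group_add \<Rightarrow> 'v"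
    and lam_l lam_r rho_l rho_r :: "'a \<Rightarrow> 'v \<Rightarrow> 'v"
    and \<phi> :: "'v \<Rightarrow> 'v" +
  fixes T :: "'v \<Rightarrow> 'a"
  assumes T_linear: "Vector_Spaces.linear sV sA T"
    and T_phi: "T (\<phi> u) = \<alpha> (T u)"
    and T_mult: "mult (T u) (T v) = T (lam_l (T u) v + lam_r (T v) u)"
    and T_br: "br (T u) (T v) = T (rho_l (T u) v + rho_r (T v) u)"

end

theory Submission
  imports Defs
begin

text \<open>
  The semidirect product on \<open>A \<oplus> V\<close> is again a Hom-Leibniz Poisson algebra, and the graph
  \<open>{(T u, u)}\<close> is a subalgebra of it isomorphic to \<open>V\<close>. The action on \<open>A\<close> in the theorem is the
  one that \<open>V\<close> induces on the quotient by this graph, which is identified with \<open>A\<close> through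
  \<open>(x, u) \<mapsto> x - T u\<close>.
\<close>

lemma linear_diff_eq: "Vector_Spaces.linear s1 s2 f \<Longrightarrow> f (x - y) = f x - f y"
  by (intro module_hom.diff[of s1 s2]) (simp add: module_hom_iff_linear)

context relative_rota_baxter
begin

definition diamond :: "'v \<Rightarrow> 'v \<Rightarrow> 'v" where
  "diamond u v = lam_l (T u) v + lam_r (T v) u"

definition br_T :: "'v \<Rightarrow> 'v \<Rightarrow> 'v" where
  "br_T u v = rho_l (T u) v + rho_r (T v) u"

text \<open>In the semidirect product, \<open>(T u, u)\<close> times \<open>(x, 0)\<close> is
  \<open>(mult (T u) x, lam_r x u)\<close>, which the identification of the quotient with
  \<open>A\<close> sends to this value. The other three arise likewise from the opposite order and
  from the bracket.\<close>

definition lam_l_bar :: "'v \<Rightarrow> 'a \<Rightarrow> 'a" where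
  "lam_l_bar u x = mult (T u) x - T (lam_r x u)"

definition lam_r_bar :: "'v \<Rightarrow> 'a \<Rightarrow> 'a" where
  "lam_r_bar u x = mult x (T u) - T (lam_l x u)"

definition rho_l_bar :: "'v \<Rightarrow> 'a \<Rightarrow> 'a" where
  "rho_l_bar u x = br (T u) x - T (rho_r x u)"

definition rho_r_bar :: "'v \<Rightarrow> 'a \<Rightarrow> 'a" where
  "rho_r_bar u x = br x (T u) - T (rho_l x u)"

lemmas bar_defs = lam_l_bar_def lam_r_bar_def rho_l_bar_def rho_r_bar_def

lemmas operators_linear =
  mult_bilinear[unfolded bilinear_product_def, THEN conjunct1, rule_format]
  mult_bilinear[unfolded bilinear_product_def, THEN conjunct2, rule_format]
  br_bilinear[unfolded bilinear_product_def, THEN conjunct1, rule_format]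
  br_bilinear[unfolded bilinear_product_def, THEN conjunct2, rule_format]
  lam_l_linear[unfolded linear_into_gl_def gl_def mem_Collect_eq, THEN conjunct1, rule_format]
  lam_l_linear[unfolded linear_into_gl_def, THEN conjunct2, rule_format]
  lam_r_linear[unfolded linear_into_gl_def gl_def mem_Collect_eq, THEN conjunct1, rule_format]
  lam_r_linear[unfolded linear_into_gl_def, THEN conjunct2, rule_format]
  rho_l_linear[unfolded linear_into_gl_def gl_def mem_Collect_eq, THEN conjunct1, rule_format]
  rho_l_linear[unfolded linear_into_gl_def, THEN conjunct2, rule_format]
  rho_r_linear[unfolded linear_into_gl_def gl_def mem_Collect_eq, THEN conjunct1, rule_format]
  rho_r_linear[unfolded linear_into_gl_def, THEN conjunct2, rule_format]
  twist_linear phi_gl[unfolded gl_def mem_Collect_eq] T_linear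

lemmas operators_add =
  operators_linear[unfolded Vector_Spaces.linear_iff, THEN conjunct2, THEN conjunct2, THEN conjunct1, rule_format]

lemmas operators_scale =
  operators_linear[unfolded Vector_Spaces.linear_iff, THEN conjunct2, THEN conjunct2, THEN conjunct2, rule_format]

lemmas operators_diff = operators_linear[THEN linear_diff_eq]

lemmas scale_laws = scale_right_distrib V.scale_right_distrib scale_right_diff_distrib

lemma T_diamond: "T (diamond u v) = mult (T u) (T v)"
  by (simp add: diamond_def T_mult)

lemma T_br_T: "T (br_T u v) = br (T u) (T v)"
  by (simp add: br_T_def T_br)

text \<open>
  Rewriting with \<open>diamond_def\<close> and \<open>br_T_def\<close> directly would also unfold the argument of \<open>T\<close> and
  so disable \<open>T_diamond\<close> and \<open>T_br_T\<close>; the next two lemmas unfold only under an action.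
\<close>

lemma action_diamond:
  "lam_l x (diamond u v) = lam_l x (lam_l (T u) v) + lam_l x (lam_r (T v) u)"
  "lam_r x (diamond u v) = lam_r x (lam_l (T u) v) + lam_r x (lam_r (T v) u)"
  "rho_l x (diamond u v) = rho_l x (lam_l (T u) v) + rho_l x (lam_r (T v) u)"
  "rho_r x (diamond u v) = rho_r x (lam_l (T u) v) + rho_r x (lam_r (T v) u)"
  by (simp_all add: diamond_def operators_add)

lemma action_br_T:
  "lam_l x (br_T u v) = lam_l x (rho_l (T u) v) + lam_l x (rho_r (T v) u)"
  "lam_r x (br_T u v) = lam_r x (rho_l (T u) v) + lam_r x (rho_r (T v) u)"
  "rho_l x (br_T u v) = rho_l x (rho_l (T u) v) + rho_l x (rho_r (T v) u)"
  "rho_r x (br_T u v) = rho_r x (rho_l (T u) v) + rho_r x (rho_r (T v) u)"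
  by (simp_all add: br_T_def operators_add)

text \<open>These are the Rota-Baxter identities at \<open>\<phi> u\<close> and \<open>v\<close>,
  restated because \<open>T_mult\<close> and \<open>T_br\<close> no longer match once
  \<open>T_phi\<close> has turned \<open>T (\<phi> u)\<close> into \<open>\<alpha> (T u)\<close>.
  Products of two plain values of \<open>T\<close> stay intact in \<open>expand_simps\<close>, so
  that \<open>lam_l_mult\<close> and its analogues still recognize them.\<close>

lemma product_twist_T:
  "mult (\<alpha> (T u)) (T v) = T (lam_l (\<alpha> (T u)) v) + T (lam_r (T v) (\<phi> u))"
  "mult (T v) (\<alpha> (T u)) = T (lam_l (T v) (\<phi> u)) + T (lam_r (\<alpha> (T u)) v)"
  "br (\<alpha> (T u)) (T v) = T (rho_l (\<alpha> (T u)) v) + T (rho_r (T v) (\<phi> u))"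
  "br (T v) (\<alpha> (T u)) = T (rho_l (T v) (\<phi> u)) + T (rho_r (\<alpha> (T u)) v)"
  using T_mult[of "\<phi> u" v] T_mult[of v "\<phi> u"] T_br[of "\<phi> u" v] T_br[of v "\<phi> u"]
  by (simp_all add: T_phi operators_add)

text \<open>\<open>T_phi\<close> moves the twist out of \<open>T\<close>; on an action it has to go
  the other way, through \<open>T\<close> and then to both arguments by equivariance.\<close>

lemma twist_T_action:
  "\<alpha> (T (lam_l x v)) = T (lam_l (\<alpha> x) (\<phi> v))"
  "\<alpha> (T (lam_r x v)) = T (lam_r (\<alpha> x) (\<phi> v))"
  "\<alpha> (T (rho_l x v)) = T (rho_l (\<alpha> x) (\<phi> v))"
  "\<alpha> (T (rho_r x v)) = T (rho_r (\<alpha> x) (\<phi> v))"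
  by (simp_all flip: T_phi add: phi_lam_l phi_lam_r rho_l_phi rho_r_phi)

lemmas twist_simps = T_phi twist_T_action twist_mult twist_br phi_lam_l phi_lam_r
  rho_l_phi[symmetric] rho_r_phi[symmetric]

lemmas expand_simps = operators_add operators_diff T_diamond T_br_T action_diamond action_br_T
  product_twist_T twist_simps

text \<open>All four are the Hom-Leibniz identity \<open>[\<alpha> a, [b, c]] = [[a, b], \<alpha> c]
  - [[a, c], \<alpha> b]\<close> of the semidirect product: first with all entries in
  \<open>A\<close>, then with \<open>c\<close>, \<open>b\<close>, \<open>a\<close> in turn taken
  from \<open>V\<close>. They serve as rewrite rules towards left-normed brackets.\<close>

lemma left_normed:
  "br (\<alpha> x) (br y z) = br (br x y) (\<alpha> z) - br (br x z) (\<alpha> y)"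
  "rho_l (\<alpha> x) (rho_l y v) = rho_l (br x y) (\<phi> v) - rho_r (\<alpha> y) (rho_l x v)"
  "rho_l (\<alpha> x) (rho_r y v) = rho_r (\<alpha> y) (rho_l x v) - rho_l (br x y) (\<phi> v)"
  "rho_r (br x y) (\<phi> v) = rho_r (\<alpha> y) (rho_r x v) - rho_r (\<alpha> x) (rho_r y v)"
  unfolding eq_diff_eq
  by (fact hom_leibniz[symmetric] rho_l_br[symmetric] rho_r_rho_l[symmetric] rho_r_rho_r[symmetric])+

lemma diamond_br_T_bilinear: "bilinear_product sV diamond" "bilinear_product sV br_T"
  by (simp_all add: bilinear_product_def Vector_Spaces.linear_iff V.vector_space_axioms
      diamond_def br_T_def operators_add operators_scale scale_laws add_ac)

lemma phi_diamond: "\<phi> (diamond u v) = diamond (\<phi> u) (\<phi> v)"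
  and phi_br_T: "\<phi> (br_T u v) = br_T (\<phi> u) (\<phi> v)"
  by (simp_all add: diamond_def br_T_def operators_add twist_simps)

lemma diamond_hom_associative: "diamond (diamond u v) (\<phi> w) = diamond (\<phi> u) (diamond v w)"
  \<comment> \<open>Only the outer products are unfolded, so the inner ones remain visible to
    \<open>T_diamond\<close> and \<open>action_diamond\<close>.\<close>
  by (simp add: diamond_def[of "diamond u v"] diamond_def[of "\<phi> u"] expand_simps
      lam_l_mult lam_r_mult lam_l_lam_r add_ac)

lemma br_T_hom_leibniz: "br_T (br_T u v) (\<phi> w) = br_T (\<phi> u) (br_T v w) + br_T (br_T u w) (\<phi> v)"
  by (simp only: br_T_def[of "br_T u v"] br_T_def[of "br_T u w"] br_T_def[of "\<phi> u"] expand_simps,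
      simp only: left_normed) (simp add: algebra_simps)

lemma br_T_hom_poisson:
  "br_T (diamond u v) (\<phi> w) = diamond (\<phi> u) (br_T v w) + diamond (br_T u w) (\<phi> v)"
  by (simp add: br_T_def[of "diamond u v"] diamond_def[of "br_T u w"] diamond_def[of "\<phi> u"]
      expand_simps rho_r_lam_l rho_r_lam_r rho_l_mult add_ac)

lemma diamond_br_T_algebra: "hom_leibniz_poisson_algebra sV diamond br_T \<phi>"
  by unfold_locales
    (fact diamond_br_T_bilinear operators_add operators_scale phi_diamond phi_br_T
      diamond_hom_associative br_T_hom_leibniz br_T_hom_poisson)+

lemma bar_linear:
  "linear_into_gl sV sA lam_l_bar" "linear_into_gl sV sA lam_r_bar"
  "linear_into_gl sV sA rho_l_bar" "linear_into_gl sV sA rho_r_bar"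
  by (simp_all add: linear_into_gl_def gl_def Vector_Spaces.linear_iff vector_space_axioms
      V.vector_space_axioms bar_defs operators_add operators_scale scale_laws algebra_simps)

lemma twist_bar:
  "\<alpha> (lam_l_bar u x) = lam_l_bar (\<phi> u) (\<alpha> x)"
  "\<alpha> (lam_r_bar u x) = lam_r_bar (\<phi> u) (\<alpha> x)"
  "\<alpha> (rho_l_bar u x) = rho_l_bar (\<phi> u) (\<alpha> x)"
  "\<alpha> (rho_r_bar u x) = rho_r_bar (\<phi> u) (\<alpha> x)"
  by (simp_all add: bar_defs expand_simps)

text \<open>In a composite such as \<open>lam_l_bar (\<phi> u) (lam_l_bar v x)\<close>, the term
  \<open>T (lam_r (T (lam_r x v)) (\<phi> u))\<close> occurs twice with opposite signs: once from
  \<open>product_twist_T\<close>, once from the correction term. What survives is Hom-associativity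
  in \<open>A\<close> and \<open>T\<close> applied to the representation identities.\<close>

lemma assoc_bar:
  "lam_l_bar (diamond u v) (\<alpha> x) = lam_l_bar (\<phi> u) (lam_l_bar v x)"
  "lam_r_bar (diamond u v) (\<alpha> x) = lam_r_bar (\<phi> v) (lam_r_bar u x)"
  "lam_l_bar (\<phi> u) (lam_r_bar v x) = lam_r_bar (\<phi> v) (lam_l_bar u x)"
  by (simp_all add: bar_defs expand_simps
      hom_associative lam_l_mult lam_r_mult lam_l_lam_r algebra_simps)

lemma leibniz_bar:
  "rho_l_bar (br_T u v) (\<alpha> x) = rho_l_bar (\<phi> u) (rho_l_bar v x) + rho_r_bar (\<phi> v) (rho_l_bar u x)"
  "rho_r_bar (\<phi> v) (rho_l_bar u x) = rho_l_bar (\<phi> u) (rho_r_bar v x) + rho_l_bar (br_T u v) (\<alpha> x)"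
  "rho_r_bar (\<phi> v) (rho_r_bar u x) = rho_r_bar (br_T u v) (\<alpha> x) + rho_r_bar (\<phi> u) (rho_r_bar v x)"
  \<comment> \<open>Reordering with \<open>left_normed\<close> creates differences under
    \<open>T\<close>, hence the second use of \<open>expand_simps\<close>.\<close>
  by (simp_all only: bar_defs expand_simps, simp_all only: left_normed expand_simps)
    (simp_all add: algebra_simps)

lemma poisson_bar:
  "rho_r_bar (\<phi> v) (lam_l_bar u x) = lam_l_bar (\<phi> u) (rho_r_bar v x) + lam_l_bar (br_T u v) (\<alpha> x)"
  "rho_r_bar (\<phi> v) (lam_r_bar u x) = lam_r_bar (br_T u v) (\<alpha> x) + lam_r_bar (\<phi> u) (rho_r_bar v x)"
  "rho_l_bar (diamond u v) (\<alpha> x) = lam_l_bar (\<phi> u) (rho_l_bar v x) + lam_r_bar (\<phi> v) (rho_l_bar u x)"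
  by (simp_all add: bar_defs expand_simps hom_poisson
      rho_r_lam_l rho_r_lam_r rho_l_mult algebra_simps)

lemma bar_rep:
  "hom_leibniz_poisson_rep sV diamond br_T \<phi> sA lam_l_bar lam_r_bar rho_l_bar rho_r_bar \<alpha>"
proof -
  \<comment> \<open>This settles the algebra axioms on \<open>V\<close>, leaving only the
    representation axioms below.\<close>
  interpret W: hom_leibniz_poisson_algebra sV diamond br_T \<phi>
    by (fact diamond_br_T_algebra)
  have twist_gl: "\<alpha> \<in> gl sA"
    using twist_linear by (simp add: gl_def)
  show ?thesis
    \<comment> \<open>Equivariance is oriented oppositely in \<open>hom_associative_rep\<close> and
      \<open>hom_leibniz_rep\<close>, so \<open>twist_bar\<close> is supplied in both
      directions.\<close>
    by unfold_locales
      (fact bar_linear twist_gl twist_bar twist_bar[symmetric] assoc_bar leibniz_bar poisson_bar)+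
qed

end

theorem theorem4p18:
  fixes sA :: "'k::field_char_0 \<Rightarrow> 'a::ab_group_add \<Rightarrow> 'a"
    and mult br :: "'a \<Rightarrow> 'a \<Rightarrow> 'a"
    and \<alpha> :: "'a \<Rightarrow> 'a"
    and sV :: "'k \<Rightarrow> 'v::ab_group_add \<Rightarrow> 'v"
    and lam_l lam_r rho_l rho_r :: "'a \<Rightarrow> 'v \<Rightarrow> 'v"
    and \<phi> :: "'v \<Rightarrow> 'v"
    and T :: "'v \<Rightarrow> 'a"
  assumes "relative_rota_baxter sA mult br \<alpha> sV lam_l lam_r rho_l rho_r \<phi> T"
  shows "hom_leibniz_poisson_rep sV
           (\<lambda>u v. lam_l (T u) v + lam_r (T v) u)
           (\<lambda>u v. rho_l (T u) v + rho_r (T v) u)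
           \<phi> sA
           (\<lambda>u x. mult (T u) x - T (lam_r x u))
           (\<lambda>u x. mult x (T u) - T (lam_l x u))
           (\<lambda>u x. br (T u) x - T (rho_r x u))
           (\<lambda>u x. br x (T u) - T (rho_l x u))
           \<alpha>"
  \<comment> \<open>The constants occur unapplied in \<open>bar_rep\<close>, so their definitions
    are used as equations between functions.\<close>
  using relative_rota_baxter.bar_rep[OF assms]
  unfolding relative_rota_baxter.diamond_def[OF assms, abs_def]
    relative_rota_baxter.br_T_def[OF assms, abs_def]
    relative_rota_baxter.bar_defs[OF assms, abs_def] .

end
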